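(* Let $k\ge 1$ and $n\geq 3$ be integers, let $r\in\mathbb{C}\setminus\{0\}$, and let $\alpha,\beta,\gamma$ be the (distinct) roots in $\mathbb{C}$ of $\phi(x)=x^3-2kx^2-kx-1$. Set $\omega_n=e^{2\pi i/n}$ and $\rho_m=r^{1/n}\omega_n^m$ for $m=0,1,\ldots,n-1$, where $r^{1/n}$ is a fixed $n$-th root of $r$. Then the eigenvalues $\lambda_0,\ldots,\lambda_{n-1}$ of $\mathbf{P}_n=\mathrm{Circ}_r(P_{k,0},P_{k,1},\ldots,P_{k,n-1})$ are given, for $m=0,1,\ldots,n-1$, as follows: 1. If $\rho_m\notin\{\alpha^{-1},\beta^{-1},\gamma^{-1}\}$, then $$\lambda_m=\frac{\rho_m-rP_{k,n}-r\rho_m(kP_{k,n-1}+P_{k,n-2})-r\rho_m^2P_{k,n-1}}{1-2k\rho_m-k\rho_m^2-\rho_m^3}.$$ 2. If $\rho_m=\alpha^{-1}$, then $$\lambda_m=\frac{n\alpha}{(\alpha-\beta)(\alpha-\gamma)}-\frac{\beta(\alpha^n-\beta^n)}{\alpha^{n-1}(\beta-\alpha)^2(\beta-\gamma)}-\frac{\gamma(\alpha^n-\gamma^n)}{\alpha^{n-1}(\gamma-\alpha)^2(\gamma-\beta)}.$$ 3. If $\rho_m=\beta^{-1}$, then $$\lambda_m=\frac{n\beta}{(\beta-\alpha)(\beta-\gamma)}-\frac{\alpha(\beta^n-\alpha^n)}{\beta^{n-1}(\alpha-\beta)^2(\alpha-\gamma)}-\frac{\gamma(\beta^n-\gamma^n)}{\beta^{n-1}(\gamma-\beta)^2(\gamma-\alpha)}.$$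 4. If $\rho_m=\gamma^{-1}$, then $$\lambda_m=\frac{n\gamma}{(\gamma-\alpha)(\gamma-\beta)}-\frac{\alpha(\gamma^n-\alpha^n)}{\gamma^{n-1}(\alpha-\gamma)^2(\alpha-\beta)}-\frac{\beta(\gamma^n-\beta^n)}{\gamma^{n-1}(\beta-\gamma)^2(\beta-\alpha)}.$$
   Context: For an integer $k\geq 1$, the generalized $k$-Pell-Tribonacci sequence $(P_{k,n})_{n\ge 0}$ is defined by $P_{k,0}=0$, $P_{k,1}=1$, $P_{k,2}=2k$ and $P_{k,n}=2kP_{k,n-1}+kP_{k,n-2}+P_{k,n-3}$ for $n\geq 3$. Its characteristic polynomial is $\phi(x)=x^3-2kx^2-kx-1$, which has three distinct complex roots. For $n\ge 2$, $r\in\mathbb{C}$ and $a_0,\dots,a_{n-1}\in\mathbb{C}$, the $r$-circulant matrix $\mathrm{Circ}_r(a_0,\dots,a_{n-1})$ is the $n\times n$ matrix whose $(i,j)$ entry ($1\le i,j\le n$) is $a_{j-i}$ if $j\ge i$ and $r\,a_{n+j-i}$ if $j<i$. Indexing convention: $\lambda_m$ denotes the eigenvalue of the $r$-circulant matrix belonging to the eigenvector $(1,\rho_m,\rho_m^2,\ldots,\rho_m^{n-1})^T$. *)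

theory Defs
  imports Complex_Main "Jordan_Normal_Form.Char_Poly"
    "HOL-Computational_Algebra.Fundamental_Theorem_Algebra"
begin

fun pell_trib :: "int \<Rightarrow> nat \<Rightarrow> int" where
  "pell_trib k 0 = 0"
| "pell_trib k (Suc 0) = 1"
| "pell_trib k (Suc (Suc 0)) = 2 * k"
| "pell_trib k (Suc (Suc (Suc n))) =
     2 * k * pell_trib k (Suc (Suc n)) + k * pell_trib k (Suc n) + pell_trib k n"

definition pell_trib_poly :: "int \<Rightarrow> complex poly" where
  "pell_trib_poly k = [: -1, - of_int k, - (2 * of_int k), 1 :]"

text \<open>The discriminant \<open>4 k^4 - 28 k^3 - 36 k^2 - 27\<close> is odd, hence nonzero.\<close>

lemma card_roots_pell_trib_poly: "card {x. poly (pell_trib_poly k) x = 0} = 3"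
proof -
  have "rsquarefree (pell_trib_poly k)"
    unfolding rsquarefree_roots
  proof (intro allI notI)
    fix x assume *: "poly (pell_trib_poly k) x = 0 \<and> poly (pderiv (pell_trib_poly k)) x = 0"
    define c :: complex where "c = of_int k"
    have 1: "x^3 - 2*c*x^2 - c*x - 1 = 0" and 2: "3*x^2 - 4*c*x - c = 0"
      using * by (auto simp: pell_trib_poly_def c_def pderiv_pCons algebra_simps
          power2_eq_square power3_eq_cube)
    define u v where "u = 8*c^2 + 6*c" and "v = 9 + 2*c^2"
    have "u * x + v
        = (3*x - 2*c) * (3*x^2 - 4*c*x - c) - 9 * (x^3 - 2*c*x^2 - c*x - 1)"
      by (simp add: u_def v_def algebra_simps power2_eq_square power3_eq_cube)
    with 1 2 have 3: "u * x + v = 0" by simp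
    have "u^2 * (3*x^2 - 4*c*x - c)
        = (u*x + v) * (3*u*x - 3*v - 4*c*u) + (3*v^2 + 4*c*u*v - c*u^2)"
      by (simp add: algebra_simps power2_eq_square)
    with 2 3 have "3*v^2 + 4*c*u*v - c*u^2 = 0" by simp
    moreover have "3*v^2 + 4*c*u*v - c*u^2 = - 9 * (4*c^4 - 28*c^3 - 36*c^2 - 27)"
      by (simp add: u_def v_def algebra_simps power2_eq_square power3_eq_cube power4_eq_xxxx)
    ultimately have "- 9 * (4*c^4 - 28*c^3 - 36*c^2 - 27) = 0" by (simp only:)
    hence "4*c^4 - 28*c^3 - 36*c^2 - 27 = 0"
      by (simp only: mult_eq_0_iff) simp
    hence "of_int (4*k^4 - 28*k^3 - 36*k^2 - 27) = (0::complex)"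
      by (simp add: c_def)
    hence "4*k^4 - 28*k^3 - 36*k^2 - 27 = 0"
      by (simp only: of_int_eq_0_iff)
    hence "even (4*k^4 - 28*k^3 - 36*k^2 - 27)" by simp
    thus False by simp
  qed
  moreover have "pell_trib_poly k \<noteq> 0" "degree (pell_trib_poly k) = 3"
    by (simp_all add: pell_trib_poly_def)
  ultimately show ?thesis
    using rsquarefree_card_degree by metis
qed

text \<open>Rows and columns are numbered from \<open>0\<close> to \<open>n - 1\<close>; the entries depend only on \<open>j - i\<close>.\<close>

definition r_circulant :: "nat \<Rightarrow> complex \<Rightarrow> (nat \<Rightarrow> complex) \<Rightarrow> complex mat" where
  "r_circulant n r a = mat n n (\<lambda>(i, j). if i \<le> j then a (j - i) else r * a (n + j - i))"

end

theory Submission imports Defs begin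

text \<open>
  If \<open>\<rho> ^ n = r\<close> then \<open>(1, \<rho>, \<dots>, \<rho> ^ (n - 1))\<close> is an eigenvector of the \<open>r\<close>-circulant matrix,
  with eigenvalue \<open>\<Sum>l<n. a l * \<rho> ^ l\<close>. The \<open>n\<close> eigenvectors obtained from the \<open>n\<close>-th roots of \<open>r\<close>
  form a scaled Fourier matrix, which is inverted explicitly; hence the matrix is diagonalisable
  and these eigenvalues are all of them, with multiplicity. Multiplying the sum by the
  reciprocal polynomial of \<open>\<phi>\<close> telescopes it, which settles the case where that polynomial does not
  vanish at \<open>\<rho>\<close>. Otherwise \<open>\<rho>\<close> is the inverse of a root of \<open>\<phi>\<close>, and Binet's formula splits the sum
  into a constant one and two geometric ones.
\<close>

section \<open>Spectrum of an \<open>r\<close>-circulant matrix\<close>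

text \<open>Read cyclically from the diagonal, row \<open>i\<close> has \<open>a l\<close> in column
  \<open>i + l\<close> modulo \<open>n\<close>. Where the column wraps around, the factor
  \<open>r = x ^ n\<close> raises \<open>x ^ j\<close> to \<open>x ^ (i + l)\<close>, so
  \<open>x ^ i\<close> factors out of the whole row.\<close>

lemma r_circulant_mult_power_vec:
  fixes x :: complex
  assumes "x ^ n = r"
  shows "r_circulant n r a *\<^sub>v vec n (\<lambda>i. x ^ i) = (\<Sum>l<n. a l * x ^ l) \<cdot>\<^sub>v vec n (\<lambda>i. x ^ i)"
proof (rule eq_vecI)
  fix i assume "i < dim_vec ((\<Sum>l<n. a l * x ^ l) \<cdot>\<^sub>v vec n (\<lambda>i. x ^ i))"
  then have i: "i < n" by simp
  have "(r_circulant n r a *\<^sub>v vec n (\<lambda>i. x ^ i)) $ i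
      = (\<Sum>j<n. (if i \<le> j then a (j - i) else r * a (n + j - i)) * x ^ j)"
    using i by (simp add: r_circulant_def scalar_prod_def atLeast0LessThan)
  also have "\<dots> = (\<Sum>l<n. a l * x ^ (i + l))"
  proof (rule sum.reindex_bij_witness
      [of _ "\<lambda>l. if l < n - i then i + l else i + l - n" "\<lambda>j. if i \<le> j then j - i else n + j - i"])
    fix j assume j: "j \<in> {..<n}"
    show "a (if i \<le> j then j - i else n + j - i) * x ^ (i + (if i \<le> j then j - i else n + j - i))
        = (if i \<le> j then a (j - i) else r * a (n + j - i)) * x ^ j"
    proof (cases "i \<le> j")
      case False
      then have "x ^ (i + (n + j - i)) = r * x ^ j"
        using i assms by (simp add: power_add[symmetric] flip: assms)
      then show ?thesis using False by simp
    qed simp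
  qed (use i in auto)
  also have "\<dots> = (\<Sum>l<n. a l * x ^ l) * x ^ i"
    by (simp add: sum_distrib_left power_add ac_simps)
  finally show "(r_circulant n r a *\<^sub>v vec n (\<lambda>i. x ^ i)) $ i
      = ((\<Sum>l<n. a l * x ^ l) \<cdot>\<^sub>v vec n (\<lambda>i. x ^ i)) $ i"
    using i by simp
qed (simp add: r_circulant_def)

text \<open>\<open>A * V = V * D\<close> holds column by column, so \<open>A\<close> is similar to
  the diagonal \<open>D\<close>. This counts multiplicities correctly even if values of
  \<open>ev\<close> coincide.\<close>

lemma char_poly_of_eigenbasis:
  fixes A :: "'a :: field mat"
  assumes A: "A \<in> carrier_mat n n" and V: "V \<in> carrier_mat n n" and W: "W \<in> carrier_mat n n"
    and WV: "W * V = 1\<^sub>m n"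
    and ev: "\<And>m. m < n \<Longrightarrow> A *\<^sub>v col V m = ev m \<cdot>\<^sub>v col V m"
  shows "char_poly A = (\<Prod>m<n. [:- ev m, 1:])"
proof -
  define D where "D = mat n n (\<lambda>(i, j). if i = j then ev i else 0)"
  have D: "D \<in> carrier_mat n n" by (simp add: D_def)
  have VW: "V * W = 1\<^sub>m n"
    using mat_mult_left_right_inverse[OF W V WV] .
  have AV: "A * V = V * D"
  proof (rule eq_matI)
    fix i j assume "i < dim_row (V * D)" "j < dim_col (V * D)"
    then have ij: "i < n" "j < n" using V D by auto
    have "(A * V) $$ (i, j) = (A *\<^sub>v col V j) $ i"
      using ij A V by simp
    also have "\<dots> = ev j * V $$ (i, j)"
      using ev[OF ij(2)] ij V by simp
    also have "\<dots> = (V * D) $$ (i, j)"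
      using ij V by (simp add: D_def scalar_prod_def if_distrib cong: if_cong)
    finally show "(A * V) $$ (i, j) = (V * D) $$ (i, j)" .
  qed (use A V D in auto)
  have "A = A * (V * W)"
    using A by (simp add: VW)
  also have "\<dots> = V * D * W"
    using A V W by (simp flip: AV)
  finally have "similar_mat_wit A D V W"
    using A V W D VW WV by (intro similar_mat_witI[where n = n])
  then have "char_poly A = char_poly D"
    by (intro char_poly_similar) (auto simp: similar_mat_def)
  also have "\<dots> = (\<Prod>a\<leftarrow>diag_mat D. [:- a, 1:])"
    by (rule char_poly_upper_triangular[OF D]) (auto simp: D_def upper_triangular_def)
  also have "\<dots> = (\<Prod>m<n. [:- ev m, 1:])"
    by (simp add: diag_mat_def D_def prod.list_conv_set_nth atLeast0LessThan)
  finally show ?thesis .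
qed

lemma power_scaled_root_of_unity:
  fixes s :: complex
  assumes "n > 0"
  shows "(s * exp (2 * of_real pi * \<i> / of_nat n) ^ m) ^ n = s ^ n"
proof -
  have "exp (2 * of_real pi * \<i> / of_nat n) ^ n = 1"
    using assms by (simp add: mult_ac flip: exp_of_nat_mult)
  \<comment> \<open>The exponents are exchanged: an \<open>n\<close>-th power of an
    \<open>m\<close>-th power is an \<open>m\<close>-th power of an \<open>n\<close>-th
    power.\<close>
  then show ?thesis
    by (simp add: power_mult_distrib power_mult[symmetric] mult.commute[of m n])
      (simp add: power_mult)
qed

lemma inj_on_powers_root_of_unity:
  assumes "n > 0"
  shows "inj_on (\<lambda>m. exp (2 * of_real pi * \<i> / of_nat n) ^ m) {..<n}"
proof -
  have "exp (2 * of_real pi * \<i> / of_nat n) ^ m = cis (2 * pi * real m / real n)" for m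
    by (simp add: cis_conv_exp mult_ac flip: exp_of_nat_mult)
  then show ?thesis
    using bij_betw_roots_unity[OF assms] by (simp add: bij_betw_def)
qed

lemma char_poly_r_circulant:
  fixes s :: complex
  assumes n: "n > 0" and s: "s \<noteq> 0" "s ^ n = r"
    and \<omega>: "\<omega> = exp (2 * of_real pi * \<i> / of_nat n)"
    and \<rho>: "\<And>m. \<rho> m = s * \<omega> ^ m"
  shows "char_poly (r_circulant n r a) = (\<Prod>m<n. [:- (\<Sum>l<n. a l * \<rho> m ^ l), 1:])"
proof (rule char_poly_of_eigenbasis)
  define V where "V = mat n n (\<lambda>(i, m). \<rho> m ^ i)"
  \<comment> \<open>The inverse Fourier matrix, rescaled for the nodes \<open>\<rho> l\<close>,
    which are nonzero because \<open>s\<close> is.\<close>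
  define W where "W = mat n n (\<lambda>(l, j). inverse (\<rho> l) ^ j / of_nat n)"
  have \<rho>n: "\<rho> m ^ n = r" for m
    using power_scaled_root_of_unity[OF n] by (simp add: \<rho> \<omega> s)
  have \<rho>0: "\<rho> m \<noteq> 0" for m
    using s by (simp add: \<rho> \<omega>)
  show "r_circulant n r a \<in> carrier_mat n n" by (simp add: r_circulant_def)
  show "V \<in> carrier_mat n n" "W \<in> carrier_mat n n" by (simp_all add: V_def W_def)
  show "r_circulant n r a *\<^sub>v col V m = (\<Sum>l<n. a l * \<rho> m ^ l) \<cdot>\<^sub>v col V m" if "m < n" for m
    using r_circulant_mult_power_vec[OF \<rho>n] that by (simp add: V_def)
  show "W * V = 1\<^sub>m n"
  proof (rule eq_matI)
    fix l m assume "l < dim_row (1\<^sub>m n)" "m < dim_col (1\<^sub>m n)"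
    then have lm: "l < n" "m < n" by auto
    \<comment> \<open>Orthogonality: the ratio of two nodes is an \<open>n\<close>-th root of unity,
      and it is 1 only for \<open>l = m\<close>; otherwise the geometric sum vanishes.\<close>
    have "(W * V) $$ (l, m) = (\<Sum>j<n. (\<rho> m / \<rho> l) ^ j) / of_nat n"
      using lm by (simp add: W_def V_def scalar_prod_def atLeast0LessThan sum_divide_distrib
          power_divide power_inverse divide_simps)
    also have "\<dots> = (if l = m then 1 else 0)"
    proof (cases "l = m")
      case True
      then show ?thesis using n \<rho>0 by simp
    next
      case False
      then have "\<omega> ^ m \<noteq> \<omega> ^ l"
        using inj_on_powers_root_of_unity[OF n] lm by (auto simp: \<omega> inj_on_def)
      then have "\<rho> m / \<rho> l \<noteq> 1"
        using s \<rho>0[of l] by (simp add: \<rho>)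
      moreover have "(\<rho> m / \<rho> l) ^ n = 1"
        using \<rho>n \<rho>0 s by (simp add: power_divide) (metis power_not_zero)
      ultimately show ?thesis
        using False by (simp add: geometric_sum)
    qed
    finally show "(W * V) $$ (l, m) = 1\<^sub>m n $$ (l, m)"
      using lm by simp
  qed (simp_all add: V_def W_def)
qed

section \<open>Vieta relations and Binet's formula\<close>

lemma pell_trib_poly_Vieta:
  assumes "\<alpha> \<noteq> \<beta>" "\<alpha> \<noteq> \<gamma>" "\<beta> \<noteq> \<gamma>"
    and "poly (pell_trib_poly k) \<alpha> = 0" "poly (pell_trib_poly k) \<beta> = 0" "poly (pell_trib_poly k) \<gamma> = 0"
  shows "of_int (2 * k) = \<alpha> + \<beta> + \<gamma>"
    and "of_int k = - (\<alpha> * \<beta> + \<alpha> * \<gamma> + \<beta> * \<gamma>)"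
    and "\<alpha> * \<beta> * \<gamma> = 1"
proof -
  define c :: complex where "c = of_int k"
  have root: "x * x * x - 2 * c * x * x - c * x - 1 = 0" if "poly (pell_trib_poly k) x = 0" for x
    using that by (simp add: pell_trib_poly_def c_def algebra_simps)
  note r = root[OF assms(4)] root[OF assms(5)] root[OF assms(6)]
  \<comment> \<open>First divided difference of the cubic at two distinct roots.\<close>
  have quot: "x * x + x * y + y * y - 2 * c * (x + y) - c = 0"
    if "x * x * x - 2 * c * x * x - c * x - 1 = 0" "y * y * y - 2 * c * y * y - c * y - 1 = 0" "x \<noteq> y"
    for x y
  proof -
    have "(x - y) * (x * x + x * y + y * y - 2 * c * (x + y) - c)
        = (x * x * x - 2 * c * x * x - c * x - 1) - (y * y * y - 2 * c * y * y - c * y - 1)"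
      by (simp add: algebra_simps)
    also have "\<dots> = 0"
      by (simp only: that(1,2) diff_self)
    finally have "(x - y) * (x * x + x * y + y * y - 2 * c * (x + y) - c) = 0" .
    then show ?thesis using that(3) by simp
  qed
  note q = quot[OF r(1) r(2) assms(1)] quot[OF r(1) r(3) assms(2)]
  \<comment> \<open>The second divided difference is linear and yields the sum of the roots; the
    other two relations follow by back-substitution.\<close>
  have "(\<beta> - \<gamma>) * (\<alpha> + \<beta> + \<gamma> - 2 * c)
      = (\<alpha> * \<alpha> + \<alpha> * \<beta> + \<beta> * \<beta> - 2 * c * (\<alpha> + \<beta>) - c)
        - (\<alpha> * \<alpha> + \<alpha> * \<gamma> + \<gamma> * \<gamma> - 2 * c * (\<alpha> + \<gamma>) - c)"
    by (simp add: algebra_simps)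
  also have "\<dots> = 0"
    by (simp only: q diff_self)
  finally have e1: "2 * c = \<alpha> + \<beta> + \<gamma>"
    using assms(3) by simp
  have "\<alpha> * \<alpha> + \<alpha> * \<beta> + \<beta> * \<beta> - (\<alpha> + \<beta> + \<gamma>) * (\<alpha> + \<beta>) - c = 0"
    using q(1) unfolding e1 .
  then have e2: "c = - (\<alpha> * \<beta> + \<alpha> * \<gamma> + \<beta> * \<gamma>)"
    by (simp add: algebra_simps)
  \<comment> \<open>\<open>e1\<close> has to be unfolded before \<open>e2\<close>, since rewriting
    \<open>c\<close> first would destroy the pattern \<open>2 * c\<close>.\<close>
  have "\<alpha> * \<alpha> * \<alpha> - (\<alpha> + \<beta> + \<gamma>) * \<alpha> * \<alpha> - (- (\<alpha> * \<beta> + \<alpha> * \<gamma> + \<beta> * \<gamma>)) * \<alpha> - 1 = 0"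
    using r(1) unfolding e1 unfolding e2 .
  then have e3: "\<alpha> * \<beta> * \<gamma> = 1"
    by (simp add: algebra_simps)
  show "of_int (2 * k) = \<alpha> + \<beta> + \<gamma>" "of_int k = - (\<alpha> * \<beta> + \<alpha> * \<gamma> + \<beta> * \<gamma>)" "\<alpha> * \<beta> * \<gamma> = 1"
    using e1 e2 e3 by (simp_all add: c_def)
qed

text \<open>Clearing denominators with the Vandermonde product lets the induction run in any
  commutative ring. Both sides satisfy the same third-order recurrence and agree at 0, 1 and
  2.\<close>

lemma pell_trib_Binet_mult:
  fixes \<alpha> \<beta> \<gamma> :: "'a :: comm_ring_1"
  assumes e: "of_int (2 * k) = \<alpha> + \<beta> + \<gamma>" "of_int k = - (\<alpha> * \<beta> + \<alpha> * \<gamma> + \<beta> * \<gamma>)" "\<alpha> * \<beta> * \<gamma> = 1"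
  shows "of_int (pell_trib k l) * ((\<alpha> - \<beta>) * (\<alpha> - \<gamma>) * (\<beta> - \<gamma>))
    = \<alpha> ^ Suc l * (\<beta> - \<gamma>) - \<beta> ^ Suc l * (\<alpha> - \<gamma>) + \<gamma> ^ Suc l * (\<alpha> - \<beta>)"
proof (induction l rule: less_induct)
  case (less l)
  \<comment> \<open>Each root annihilates the cubic rebuilt from the elementary symmetric
    functions.\<close>
  have rec: "x * x * x = of_int (2 * k) * x * x + of_int k * x + 1" if "x \<in> {\<alpha>, \<beta>, \<gamma>}" for x
  proof -
    have "x * x * x = (\<alpha> + \<beta> + \<gamma>) * x * x + (- (\<alpha> * \<beta> + \<alpha> * \<gamma> + \<beta> * \<gamma>)) * x + \<alpha> * \<beta> * \<gamma>"
      using that by (elim insertE emptyE) (simp_all add: algebra_simps)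
    then show ?thesis unfolding e .
  qed
  define f where "f i = \<alpha> ^ Suc i * (\<beta> - \<gamma>) - \<beta> ^ Suc i * (\<alpha> - \<gamma>) + \<gamma> ^ Suc i * (\<alpha> - \<beta>)" for i
  define D where "D = (\<alpha> - \<beta>) * (\<alpha> - \<gamma>) * (\<beta> - \<gamma>)"
  \<comment> \<open>The last disjunct covers \<open>l\<close> from 3 on, where the subtraction is
    not truncated.\<close>
  have "l = 0 \<or> l = 1 \<or> l = 2 \<or> l = Suc (Suc (Suc (l - 3)))"
    by linarith
  then consider "l = 0" | "l = 1" | "l = 2" | p where "l = Suc (Suc (Suc p))"
    by blast
  then have "of_int (pell_trib k l) * D = f l"
  proof cases
    case 3
    have "of_int (pell_trib k l) = \<alpha> + \<beta> + \<gamma>"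
      using 3 e(1) by (simp add: numeral_2_eq_2)
    then show ?thesis
      unfolding D_def f_def by (simp add: 3 numeral_2_eq_2 algebra_simps)
  next
    case 4
    have pow: "x ^ Suc l = of_int (2 * k) * x ^ Suc (Suc (Suc p)) + of_int k * x ^ Suc (Suc p) + x ^ Suc p"
      if "x \<in> {\<alpha>, \<beta>, \<gamma>}" for x
    proof -
      have "x ^ Suc l = x ^ Suc p * (x * x * x)" by (simp add: 4 ac_simps)
      then show ?thesis unfolding rec[OF that] by (simp add: algebra_simps)
    qed
    have IH: "of_int (pell_trib k i) * D = f i" if "i < l" for i
      using less.IH[OF that] by (simp add: D_def f_def)
    have "of_int (pell_trib k l) * D = of_int (2 * k) * (of_int (pell_trib k (Suc (Suc p))) * D)
        + of_int k * (of_int (pell_trib k (Suc p)) * D) + of_int (pell_trib k p) * D"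
      by (simp add: 4 algebra_simps)
    also have "\<dots> = of_int (2 * k) * f (Suc (Suc p)) + of_int k * f (Suc p) + f p"
      by (simp add: IH 4)
    also have "\<dots> = f l"
      using pow unfolding f_def by (simp add: algebra_simps del: power_Suc)
    finally show ?thesis .
  qed (simp_all add: D_def f_def algebra_simps)
  then show ?case by (simp add: D_def f_def)
qed

text \<open>Division by the Vandermonde product \<open>D\<close>. The middle term changes sign
  because \<open>(\<beta> - \<alpha>) * (\<beta> - \<gamma>) * (\<alpha> - \<gamma>) = -
  D\<close>.\<close>

lemma pell_trib_Binet:
  fixes \<alpha> \<beta> \<gamma> :: "'a :: field"
  assumes "\<alpha> \<noteq> \<beta>" "\<alpha> \<noteq> \<gamma>" "\<beta> \<noteq> \<gamma>"
    and "of_int (2 * k) = \<alpha> + \<beta> + \<gamma>" "of_int k = - (\<alpha> * \<beta> + \<alpha> * \<gamma> + \<beta> * \<gamma>)" "\<alpha> * \<beta> * \<gamma> = 1"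
  shows "of_int (pell_trib k l) = \<alpha> ^ Suc l / ((\<alpha> - \<beta>) * (\<alpha> - \<gamma>))
    + \<beta> ^ Suc l / ((\<beta> - \<alpha>) * (\<beta> - \<gamma>)) + \<gamma> ^ Suc l / ((\<gamma> - \<alpha>) * (\<gamma> - \<beta>))"
proof -
  define D where "D = (\<alpha> - \<beta>) * (\<alpha> - \<gamma>) * (\<beta> - \<gamma>)"
  have D: "D \<noteq> 0" using assms(1-3) by (simp add: D_def)
  have "A / ((\<alpha> - \<beta>) * (\<alpha> - \<gamma>)) = A * (\<beta> - \<gamma>) / D" for A
    using assms(1-3) by (simp add: D_def)
  moreover have "B / ((\<beta> - \<alpha>) * (\<beta> - \<gamma>)) = - (B * (\<alpha> - \<gamma>)) / D" for B
  proof -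
    have "(\<beta> - \<alpha>) * (\<beta> - \<gamma>) \<noteq> 0" using assms(1-3) by simp
    from frac_eq_eq[OF this D] show ?thesis by (simp add: D_def algebra_simps)
  qed
  moreover have "C / ((\<gamma> - \<alpha>) * (\<gamma> - \<beta>)) = C * (\<alpha> - \<beta>) / D" for C
  proof -
    have "(\<gamma> - \<alpha>) * (\<gamma> - \<beta>) \<noteq> 0" using assms(1-3) by simp
    from frac_eq_eq[OF this D] show ?thesis by (simp add: D_def algebra_simps)
  qed
  moreover have "of_int (pell_trib k l)
      = (\<alpha> ^ Suc l * (\<beta> - \<gamma>) - \<beta> ^ Suc l * (\<alpha> - \<gamma>) + \<gamma> ^ Suc l * (\<alpha> - \<beta>)) / D"
    using pell_trib_Binet_mult[OF assms(4-6), of l] D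
    by (simp only: D_def nonzero_eq_divide_eq not_False_eq_True)
  ultimately show ?thesis
    by (simp only: add_divide_distrib diff_conv_add_uminus)
qed

section \<open>Closed forms of the eigenvalue sum\<close>

text \<open>A truncated generating function times its denominator: the recurrence cancels the middle
  coefficients, leaving the initial \<open>x\<close> and the overflow at the upper end. The factor
  \<open>x ^ (n + 2)\<close> stays separate because it later becomes \<open>r\<close>.\<close>

lemma sum_pell_trib_powers:
  fixes x :: "'a :: comm_ring_1"
  shows "(\<Sum>l<Suc (Suc n). of_int (pell_trib k l) * x ^ l) * (1 - 2 * of_int k * x - of_int k * x ^ 2 - x ^ 3)
    = x - x ^ (n + 2) * of_int (pell_trib k (n + 2))
      - x ^ (n + 2) * x * (of_int k * of_int (pell_trib k (n + 1)) + of_int (pell_trib k n))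
      - x ^ (n + 2) * x ^ 2 * of_int (pell_trib k (n + 1))"
proof (induction n)
  case 0
  then show ?case by (simp add: algebra_simps power2_eq_square power3_eq_cube)
next
  case (Suc n)
  then show ?case
    by (subst sum.lessThan_Suc) (simp add: distrib_right, simp add: algebra_simps power2_eq_square power3_eq_cube)
qed

text \<open>The contribution of another root \<open>b\<close> at \<open>inverse a\<close> is
  geometric with ratio \<open>b / a\<close>, which differs from 1.\<close>

lemma sum_Binet_at_inverse_root:
  fixes a b c :: "'a :: field"
  assumes ne: "a \<noteq> b" and a0: "a \<noteq> 0"
    shows "(\<Sum>l<n. b ^ Suc l / ((b - a) * (b - c)) * inverse a ^ l)
      = - (b * (a ^ n - b ^ n) / (a ^ (n - 1) * (b - a) ^ 2 * (b - c)))"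
\<comment> \<open>For \<open>n = 0\<close> both sides vanish; otherwise \<open>n - 1\<close> is a
  true predecessor.\<close>
proof (cases n)
  case (Suc p)
  have "(\<Sum>l<n. b ^ Suc l / ((b - a) * (b - c)) * inverse a ^ l) = b / ((b - a) * (b - c)) * (\<Sum>l<n. (b / a) ^ l)"
    by (simp add: sum_distrib_left divide_inverse power_mult_distrib mult_ac)
  also have "(\<Sum>l<n. (b / a) ^ l) = ((b / a) ^ n - 1) / (b / a - 1)"
    using ne a0 by (intro geometric_sum) simp
  also have "\<dots> = - ((a ^ n - b ^ n) / (a ^ (n - 1) * (b - a)))"
    using ne a0 Suc by (simp add: power_divide divide_simps)
  finally show ?thesis
    by (simp add: power2_eq_square mult_ac)
qed simp

text \<open>In Binet's formula the powers of \<open>a\<close> cancel against those of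
  \<open>inverse a\<close>, giving \<open>n\<close> equal terms; the other two roots give geometric
  sums.\<close>

lemma sum_pell_trib_at_inverse_root:
  fixes a b c :: "'a :: field"
  assumes ne: "a \<noteq> b" "a \<noteq> c" "b \<noteq> c"
    and e: "of_int (2 * k) = a + b + c" "of_int k = - (a * b + a * c + b * c)" "a * b * c = 1"
  shows "(\<Sum>l<n. of_int (pell_trib k l) * inverse a ^ l) = of_nat n * a / ((a - b) * (a - c))
          - b * (a ^ n - b ^ n) / (a ^ (n - 1) * (b - a) ^ 2 * (b - c))
          - c * (a ^ n - c ^ n) / (a ^ (n - 1) * (c - a) ^ 2 * (c - b))"
proof -
  have a0: "a \<noteq> 0" using e(3) by auto
  have "(\<Sum>l<n. of_int (pell_trib k l) * inverse a ^ l)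
      = (\<Sum>l<n. a ^ Suc l / ((a - b) * (a - c)) * inverse a ^ l)
      + (\<Sum>l<n. b ^ Suc l / ((b - a) * (b - c)) * inverse a ^ l)
      + (\<Sum>l<n. c ^ Suc l / ((c - a) * (c - b)) * inverse a ^ l)"
    by (simp only: pell_trib_Binet[OF ne e] distrib_right sum.distrib)
  also have "(\<Sum>l<n. a ^ Suc l / ((a - b) * (a - c)) * inverse a ^ l) = (\<Sum>l<n. a / ((a - b) * (a - c)))"
    using a0 by (intro sum.cong) (simp_all add: power_inverse)
  finally show ?thesis
    using sum_Binet_at_inverse_root[OF ne(1) a0] sum_Binet_at_inverse_root[OF ne(2) a0] by simp
qed

text \<open>The eigenvectors fix which \<open>ev m\<close> belongs to \<open>\<rho> m\<close>; the
  characteristic polynomial adds that these are all the eigenvalues, with multiplicity.\<close>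

theorem theorem3:
  fixes k :: int and n :: nat and r s \<alpha> \<beta> \<gamma> :: complex
    and \<omega> :: complex and \<rho> :: "nat \<Rightarrow> complex" and P :: "nat \<Rightarrow> complex"
  assumes "k \<ge> 1" and "n \<ge> 3" and "r \<noteq> 0"
    and "distinct [\<alpha>, \<beta>, \<gamma>]"
    and "{x. poly (pell_trib_poly k) x = 0} = {\<alpha>, \<beta>, \<gamma>}"
    and "s ^ n = r"
    and "\<omega> = exp (2 * of_real pi * \<i> / of_nat n)"
    and "\<And>m. \<rho> m = s * \<omega> ^ m"
    and "\<And>l. P l = of_int (pell_trib k l)"
  shows "\<exists>ev :: nat \<Rightarrow> complex.
    (\<forall>m<n. eigenvector (r_circulant n r P) (vec n (\<lambda>i. \<rho> m ^ i)) (ev m)) \<and>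
    char_poly (r_circulant n r P) = (\<Prod>m<n. [:- ev m, 1:]) \<and>
    (\<forall>m<n.
      (\<rho> m \<notin> {inverse \<alpha>, inverse \<beta>, inverse \<gamma>} \<longrightarrow>
        ev m = (\<rho> m - r * P n - r * \<rho> m * (of_int k * P (n - 1) + P (n - 2)) - r * \<rho> m ^ 2 * P (n - 1))
          / (1 - 2 * of_int k * \<rho> m - of_int k * \<rho> m ^ 2 - \<rho> m ^ 3)) \<and>
      (\<rho> m = inverse \<alpha> \<longrightarrow>
        ev m = of_nat n * \<alpha> / ((\<alpha> - \<beta>) * (\<alpha> - \<gamma>))
          - \<beta> * (\<alpha> ^ n - \<beta> ^ n) / (\<alpha> ^ (n - 1) * (\<beta> - \<alpha>) ^ 2 * (\<beta> - \<gamma>))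
          - \<gamma> * (\<alpha> ^ n - \<gamma> ^ n) / (\<alpha> ^ (n - 1) * (\<gamma> - \<alpha>) ^ 2 * (\<gamma> - \<beta>))) \<and>
      (\<rho> m = inverse \<beta> \<longrightarrow>
        ev m = of_nat n * \<beta> / ((\<beta> - \<alpha>) * (\<beta> - \<gamma>))
          - \<alpha> * (\<beta> ^ n - \<alpha> ^ n) / (\<beta> ^ (n - 1) * (\<alpha> - \<beta>) ^ 2 * (\<alpha> - \<gamma>))
          - \<gamma> * (\<beta> ^ n - \<gamma> ^ n) / (\<beta> ^ (n - 1) * (\<gamma> - \<beta>) ^ 2 * (\<gamma> - \<alpha>))) \<and>
      (\<rho> m = inverse \<gamma> \<longrightarrow>
        ev m = of_nat n * \<gamma> / ((\<gamma> - \<alpha>) * (\<gamma> - \<beta>))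
          - \<alpha> * (\<gamma> ^ n - \<alpha> ^ n) / (\<gamma> ^ (n - 1) * (\<alpha> - \<gamma>) ^ 2 * (\<alpha> - \<beta>))
          - \<beta> * (\<gamma> ^ n - \<beta> ^ n) / (\<gamma> ^ (n - 1) * (\<beta> - \<gamma>) ^ 2 * (\<beta> - \<alpha>))))"
proof -
  define ev where "ev m = (\<Sum>l<n. P l * \<rho> m ^ l)" for m
  have s0: "s \<noteq> 0" using \<open>s ^ n = r\<close> \<open>r \<noteq> 0\<close> \<open>n \<ge> 3\<close> by auto
  have n0: "n > 0" using \<open>n \<ge> 3\<close> by simp
  have \<rho>n: "\<rho> m ^ n = r" for m
    using power_scaled_root_of_unity[OF n0] assms(6-8) by simp
  have ne: "\<alpha> \<noteq> \<beta>" "\<alpha> \<noteq> \<gamma>" "\<beta> \<noteq> \<gamma>" using assms(4) by auto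
  have roots: "poly (pell_trib_poly k) \<alpha> = 0" "poly (pell_trib_poly k) \<beta> = 0"
    "poly (pell_trib_poly k) \<gamma> = 0"
    using assms(5) by auto
  note e = pell_trib_poly_Vieta[OF ne roots]
  have eigen: "eigenvector (r_circulant n r P) (vec n (\<lambda>i. \<rho> m ^ i)) (ev m)" for m
  proof -
    \<comment> \<open>The leading entry is \<open>\<rho> m ^ 0 = 1\<close>, so the vector is
      nonzero.\<close>
    have "vec n (\<lambda>i. \<rho> m ^ i) $ 0 \<noteq> 0\<^sub>v n $ 0" using n0 by simp
    then have "vec n (\<lambda>i. \<rho> m ^ i) \<noteq> 0\<^sub>v n" by metis
    then show ?thesis
      using r_circulant_mult_power_vec[OF \<rho>n, of P m]
      by (simp add: eigenvector_def ev_def r_circulant_def)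
  qed
  have char: "char_poly (r_circulant n r P) = (\<Prod>m<n. [:- ev m, 1:])"
    unfolding ev_def by (rule char_poly_r_circulant[OF n0 s0 assms(6,7,8)])
  have generic: "ev m = (\<rho> m - r * P n - r * \<rho> m * (of_int k * P (n - 1) + P (n - 2)) - r * \<rho> m ^ 2 * P (n - 1))
          / (1 - 2 * of_int k * \<rho> m - of_int k * \<rho> m ^ 2 - \<rho> m ^ 3)"
    if not_inv: "\<rho> m \<notin> {inverse \<alpha>, inverse \<beta>, inverse \<gamma>}" for m
  proof -
    obtain p where p: "n = Suc (Suc p)"
      using \<open>n \<ge> 3\<close> by (intro that[of "n - 2"]) linarith
    \<comment> \<open>By Vieta the denominator is the reciprocal polynomial of the cubic, whose
      zeros are the inverses of the roots.\<close>
    have "(1 - \<alpha> * \<rho> m) * (1 - \<beta> * \<rho> m) * (1 - \<gamma> * \<rho> m) = 1 - (\<alpha> + \<beta> + \<gamma>) * \<rho> m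
        - (- (\<alpha> * \<beta> + \<alpha> * \<gamma> + \<beta> * \<gamma>)) * \<rho> m ^ 2 - \<alpha> * \<beta> * \<gamma> * \<rho> m ^ 3"
      by (simp add: algebra_simps power2_eq_square power3_eq_cube)
    also have "\<dots> = 1 - 2 * of_int k * \<rho> m - of_int k * \<rho> m ^ 2 - \<rho> m ^ 3"
      unfolding e(3) e(1,2)[symmetric] by simp
    finally have "1 - 2 * of_int k * \<rho> m - of_int k * \<rho> m ^ 2 - \<rho> m ^ 3
        = (1 - \<alpha> * \<rho> m) * (1 - \<beta> * \<rho> m) * (1 - \<gamma> * \<rho> m)" ..
    moreover have "1 - x * \<rho> m \<noteq> 0" if "\<rho> m \<noteq> inverse x" for x
      using that inverse_unique[of x "\<rho> m"] by auto
    ultimately have "1 - 2 * of_int k * \<rho> m - of_int k * \<rho> m ^ 2 - \<rho> m ^ 3 \<noteq> 0"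
      using not_inv by simp
    then show ?thesis
      using sum_pell_trib_powers[where n = p and k = k and x = "\<rho> m"] \<rho>n[of m]
      by (simp add: ev_def assms(9) p nonzero_eq_divide_eq del: power_Suc sum.lessThan_Suc)
  qed
  \<comment> \<open>Stated for the roots in any order, so that the three exceptional cases are
    permutations of one formula.\<close>
  have at_inverse_root: "ev m = of_nat n * a / ((a - b) * (a - c))
          - b * (a ^ n - b ^ n) / (a ^ (n - 1) * (b - a) ^ 2 * (b - c))
          - c * (a ^ n - c ^ n) / (a ^ (n - 1) * (c - a) ^ 2 * (c - b))"
    if "\<rho> m = inverse a" "a \<noteq> b" "a \<noteq> c" "b \<noteq> c" "poly (pell_trib_poly k) a = 0"
      "poly (pell_trib_poly k) b = 0" "poly (pell_trib_poly k) c = 0" for m a b c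
    unfolding ev_def assms(9) that(1)
    by (rule sum_pell_trib_at_inverse_root[OF that(2-4) pell_trib_poly_Vieta[OF that(2-)]])
  show ?thesis
    by (intro exI[of _ ev] conjI allI impI eigen char generic at_inverse_root)
      (use ne roots in blast)+
qed

end
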